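(* Rational PH curves are precisely the trajectories $\mathbf{r}=-2\alpha^{-1}\mathbf{b}$ of the origin under the rational motions $\mathcal{C} = (\alpha + \varepsilon \mathbf{b})\mathcal{A}$, where $\alpha\in\mathbb{R}[t]\setminus\{0\}$, $\mathbf{b}\in\mathbb{H}[t]$ is vectorial, $\mathcal{A}\in\mathbb{H}[t]$ is reduced with respect to $\mathbf{i}$, and one of the following conditions, which are equivalent for such $\alpha,\mathbf{b},\mathcal{A}$, is satisfied: 1. $(\alpha \mathbf{b}' - \alpha' \mathbf{b}) \times \mathcal{A}\, \mathbf{i}\, \mathcal{A}^\ast = 0$; 2. $\langle \alpha \mathbf{b}' - \alpha'\mathbf{b},\ \mathcal{A}\, \mathbf{j}\, \mathcal{A}^\ast \rangle = \langle \alpha \mathbf{b}' - \alpha'\mathbf{b},\ \mathcal{A}\, \mathbf{k}\, \mathcal{A}^\ast \rangle = 0$; 3. there exists $\mu \in \mathbb{R}[t]$ such that $\alpha \mathbf{b}' - \alpha' \mathbf{b} = \mu\, \mathcal{A}\, \mathbf{i}\, \mathcal{A}^\ast$.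
   Context: $\mathbb{H}$ is the real algebra of quaternions with basis $1,\mathbf{i},\mathbf{j},\mathbf{k}$; $\mathbb{H}[t]$ is the ring of polynomials with quaternion coefficients in an indeterminate $t$ commuting with all coefficients; $'$ is the derivative with respect to $t$. $\ast$ denotes quaternion conjugation (coefficientwise on polynomials). A quaternion polynomial $\mathcal{B}$ is vectorial if $\mathcal{B}+\mathcal{B}^\ast=0$; vectorial quaternions $x_1\mathbf{i}+x_2\mathbf{j}+x_3\mathbf{k}$ are identified with vectors $(x_1,x_2,x_3)$, and $\times$, $\langle\cdot,\cdot\rangle$ are the usual cross product and scalar product (extended to polynomial entries). $\mathcal{A}\in\mathbb{H}[t]$ is reduced with respect to $\mathbf{i}$ if it has no real polynomial factor of positive degree and no polynomial right factor of positive degree with coefficients in the subalgebra of $\mathbb{H}$ generated by $1$ and $\mathbf{i}$ (in particular $\mathcal{A}\ne 0$). The dual quaternions are $\mathbb{H}+\varepsilon\mathbb{H}$ with $\varepsilon$ commuting with quaternions and $\varepsilon^2=0$. A rational motion is given by a motion polynomial $\mathcal{P}+\varepsilon\mathcal{D}$ with $\mathcal{P},\mathcal{D}\in\mathbb{H}[t]$, $\mathcal{P}\ne0$, $\mathcal{P}\mathcal{D}^\ast+\mathcal{D}\mathcal{P}^\ast=0$. The trajectory of the origin is $(\mathcal{P}\mathcal{D}^\ast-\mathcal{D}\mathcal{P}^\ast)/(\mathcal{P}\mathcal{P}^\ast)$, which for $\mathcal{C}=(\alpha+\varepsilon\mathbf{b})\mathcal{A}$ equals $-2\alpha^{-1}\mathbf{b}$.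 A rational curve $\mathbf{r}=(r_1,r_2,r_3)\in\mathbb{R}(t)^3$ is a rational PH curve if there is $\sigma\in\mathbb{R}(t)$ with $(r_1')^2+(r_2')^2+(r_3')^2=\sigma^2$ (polynomial and constant curves are included). *)

theory Defs
  imports
    "HOL-Computational_Algebra.Polynomial_Factorial"
    "HOL-Analysis.Cartesian_Space"
begin

subsection \<open>Quaternions over a commutative ring\<close>

text \<open>
  The Hamilton quaternions \<open>a + b \<i> + c \<j> + d \<k>\<close> over a commutative ring of scalars. The instances
  used are \<open>real quat\<close> for \<open>\<bbbH>\<close>, \<open>real poly quat\<close> for \<open>\<bbbH>[t]\<close> and
  \<open>real poly fract quat\<close> for quaternions over the field \<open>\<real>(t)\<close>. The library type \<open>poly\<close> has a
  multiplication only over commutative coefficients, so \<open>\<real>[t] \<otimes> \<bbbH>\<close> is used for \<open>\<bbbH>[t]\<close>. That this is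
  the ring of polynomials in a central indeterminate with coefficients in \<open>\<bbbH>\<close> is shown below by the
  lemmas on \<open>qcoeff\<close>: an element is the same as a finitely supported coefficient sequence in
  \<open>real quat\<close>, and multiplication is convolution of these sequences.
\<close>

datatype 'a quat = Quat (re: 'a) (im1: 'a) (im2: 'a) (im3: 'a)

instantiation quat :: (comm_ring_1) ring_1
begin

definition zero_quat :: "'a quat" where "0 = Quat 0 0 0 0"

definition one_quat :: "'a quat" where "1 = Quat 1 0 0 0"

definition plus_quat :: "'a quat \<Rightarrow> 'a quat \<Rightarrow> 'a quat" where
  "x + y = Quat (re x + re y) (im1 x + im1 y) (im2 x + im2 y) (im3 x + im3 y)"

definition uminus_quat :: "'a quat \<Rightarrow> 'a quat" where
  "- x = Quat (- re x) (- im1 x) (- im2 x) (- im3 x)"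

definition minus_quat :: "'a quat \<Rightarrow> 'a quat \<Rightarrow> 'a quat" where
  "x - y = Quat (re x - re y) (im1 x - im1 y) (im2 x - im2 y) (im3 x - im3 y)"

definition times_quat :: "'a quat \<Rightarrow> 'a quat \<Rightarrow> 'a quat" where
  "x * y = Quat
     (re x * re y - im1 x * im1 y - im2 x * im2 y - im3 x * im3 y)
     (re x * im1 y + im1 x * re y + im2 x * im3 y - im3 x * im2 y)
     (re x * im2 y - im1 x * im3 y + im2 x * re y + im3 x * im1 y)
     (re x * im3 y + im1 x * im2 y - im2 x * im1 y + im3 x * re y)"

instance
  by standard
    (simp_all add: zero_quat_def one_quat_def plus_quat_def uminus_quat_def minus_quat_def
      times_quat_def quat.expand algebra_simps)

end

definition qi :: "'a::comm_ring_1 quat" ("\<i>\<^sub>q") where "\<i>\<^sub>q = Quat 0 1 0 0"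
definition qj :: "'a::comm_ring_1 quat" ("\<j>\<^sub>q") where "\<j>\<^sub>q = Quat 0 0 1 0"
definition qk :: "'a::comm_ring_1 quat" ("\<k>\<^sub>q") where "\<k>\<^sub>q = Quat 0 0 0 1"

definition qscalar :: "'a::comm_ring_1 \<Rightarrow> 'a quat" where
  "qscalar a = Quat a 0 0 0"

definition qcnj :: "'a::comm_ring_1 quat \<Rightarrow> 'a quat" where
  "qcnj x = Quat (re x) (- im1 x) (- im2 x) (- im3 x)"

definition vectorial :: "'a::comm_ring_1 quat \<Rightarrow> bool" where
  "vectorial x \<longleftrightarrow> x + qcnj x = 0"

text \<open>
  On vectorial quaternions, \<open>qvec\<close> is the identification with vectors; the library's cross and inner
  products are restricted to real entries, hence the versions over a commutative ring.
\<close>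

definition qvec :: "'a::comm_ring_1 quat \<Rightarrow> 'a ^ 3" where
  "qvec x = vector [im1 x, im2 x, im3 x]"

definition vcross :: "'a::comm_ring_1 ^ 3 \<Rightarrow> 'a ^ 3 \<Rightarrow> 'a ^ 3" where
  "vcross a b = vector [a$2 * b$3 - a$3 * b$2, a$3 * b$1 - a$1 * b$3, a$1 * b$2 - a$2 * b$1]"

definition vdot :: "'a::comm_ring_1 ^ 'n \<Rightarrow> 'a ^ 'n \<Rightarrow> 'a" where
  "vdot a b = (\<Sum>i\<in>UNIV. a$i * b$i)"


subsection \<open>Quaternion polynomials\<close>

definition qcoeff :: "'a::zero poly quat \<Rightarrow> nat \<Rightarrow> 'a quat" where
  "qcoeff A n = map_quat (\<lambda>p. coeff p n) A"

definition qdegree :: "'a::comm_ring_1 poly quat \<Rightarrow> nat" where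
  "qdegree A = (LEAST n. \<forall>i>n. qcoeff A i = 0)"

definition qderiv :: "real poly quat \<Rightarrow> real poly quat" where
  "qderiv A = map_quat pderiv A"

lemma qcoeff_sel [simp]:
  "re (qcoeff A n) = coeff (re A) n" "im1 (qcoeff A n) = coeff (im1 A) n"
  "im2 (qcoeff A n) = coeff (im2 A) n" "im3 (qcoeff A n) = coeff (im3 A) n"
  by (simp_all add: qcoeff_def quat.map_sel)

lemma sel_zero_quat [simp]: "re 0 = 0" "im1 0 = 0" "im2 0 = 0" "im3 0 = 0"
  by (simp_all add: zero_quat_def)

lemma sel_plus_quat [simp]:
  "re (x + y) = re x + re y" "im1 (x + y) = im1 x + im1 y"
  "im2 (x + y) = im2 x + im2 y" "im3 (x + y) = im3 x + im3 y"
  by (simp_all add: plus_quat_def)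

lemma sel_sum_quat:
  "re (sum f S) = (\<Sum>i\<in>S. re (f i))" "im1 (sum f S) = (\<Sum>i\<in>S. im1 (f i))"
  "im2 (sum f S) = (\<Sum>i\<in>S. im2 (f i))" "im3 (sum f S) = (\<Sum>i\<in>S. im3 (f i))"
  by (induction S rule: infinite_finite_induct; simp)+

lemma qcoeff_zero: "qcoeff 0 n = (0 :: 'a::comm_ring_1 quat)"
  by (simp add: quat.expand)

lemma qcoeff_one: "qcoeff 1 n = (if n = 0 then 1 else 0 :: 'a::comm_ring_1 quat)"
  by (simp add: quat.expand one_quat_def zero_quat_def)

lemma qcoeff_add: "qcoeff (A + B) n = qcoeff A n + (qcoeff B n :: 'a::comm_ring_1 quat)"
  by (simp add: quat.expand)

lemma qcoeff_mult:
  "qcoeff (A * B) n = (\<Sum>i\<le>n. qcoeff A i * (qcoeff B (n - i) :: 'a::comm_ring_1 quat))"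
  by (rule quat.expand)
    (simp add: sel_sum_quat times_quat_def coeff_mult sum.distrib sum_subtractf)

lemma qcoeff_cnj: "qcoeff (qcnj A) n = qcnj (qcoeff A n :: 'a::comm_ring_1 quat)"
  by (simp add: quat.expand qcnj_def)

lemma qcoeff_scalar: "qcoeff (qscalar p) n = qscalar (coeff p n :: 'a::comm_ring_1)"
  by (simp add: quat.expand qscalar_def)

lemma qcoeff_deriv: "qcoeff (qderiv A) n = of_nat (Suc n) * qcoeff A (Suc n)"
proof -
  have "(of_nat m :: real quat) = Quat (of_nat m) 0 0 0" for m
    by (induction m) (simp_all add: zero_quat_def one_quat_def plus_quat_def)
  then show ?thesis
    by (simp add: quat.expand qderiv_def quat.map_sel coeff_pderiv times_quat_def del: of_nat_Suc)
qed

lemma qcoeff_inj: "qcoeff A = qcoeff B \<longleftrightarrow> A = (B :: 'a::comm_ring_1 poly quat)"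
  by (metis poly_eqI qcoeff_sel quat.expand)

lemma qcoeff_surj:
  fixes f :: "nat \<Rightarrow> 'a::comm_ring_1 quat"
  assumes "\<forall>i>n. f i = 0"
  shows "\<exists>A. qcoeff A = f"
proof -
  have "coeff (Abs_poly g) = g" if "\<forall>i>n. g i = 0" for g :: "nat \<Rightarrow> 'a"
    using that by (intro coeff_Abs_poly[of n]) auto
  then have "qcoeff (Quat (Abs_poly (re \<circ> f)) (Abs_poly (im1 \<circ> f))
      (Abs_poly (im2 \<circ> f)) (Abs_poly (im3 \<circ> f))) = f"
    using assms by (intro ext) (simp add: quat.expand)
  then show ?thesis ..
qed

definition reduced_wrt_i :: "real poly quat \<Rightarrow> bool" where
  "reduced_wrt_i A \<longleftrightarrow>
     (\<nexists>p B. degree p > 0 \<and> A = qscalar p * B) \<and>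
     (\<nexists>B G. qdegree G > 0 \<and> (\<forall>n. \<exists>x y. qcoeff G n = qscalar x + qscalar y * \<i>\<^sub>q) \<and> A = B * G)"

lemma reduced_wrt_i_nonzero: "reduced_wrt_i A \<Longrightarrow> A \<noteq> 0"
proof
  assume "reduced_wrt_i A" "A = 0"
  moreover have "degree [:0, 1 :: real:] > 0" by simp
  moreover have "(0 :: real poly quat) = qscalar [:0, 1:] * 0" by simp
  ultimately show False unfolding reduced_wrt_i_def by blast
qed


subsection \<open>Dual quaternions and rational motions\<close>

text \<open>
  The value \<open>Dual p d\<close> is \<open>p + \<epsilon> d\<close> with \<open>\<epsilon>\<close> central and \<open>\<epsilon>\<^sup>2 = 0\<close>.
\<close>

datatype 'a dual = Dual (primal_part: 'a) (dual_part: 'a)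

instantiation dual :: (ring_1) ring_1
begin

definition zero_dual :: "'a dual" where "0 = Dual 0 0"

definition one_dual :: "'a dual" where "1 = Dual 1 0"

definition plus_dual :: "'a dual \<Rightarrow> 'a dual \<Rightarrow> 'a dual" where
  "x + y = Dual (primal_part x + primal_part y) (dual_part x + dual_part y)"

definition uminus_dual :: "'a dual \<Rightarrow> 'a dual" where
  "- x = Dual (- primal_part x) (- dual_part x)"

definition minus_dual :: "'a dual \<Rightarrow> 'a dual \<Rightarrow> 'a dual" where
  "x - y = Dual (primal_part x - primal_part y) (dual_part x - dual_part y)"

definition times_dual :: "'a dual \<Rightarrow> 'a dual \<Rightarrow> 'a dual" where
  "x * y = Dual (primal_part x * primal_part y)
     (primal_part x * dual_part y + dual_part x * primal_part y)"

instance
  by standard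
    (simp_all add: zero_dual_def one_dual_def plus_dual_def uminus_dual_def minus_dual_def
      times_dual_def dual.expand algebra_simps)

end

definition dual_embed :: "'a::zero \<Rightarrow> 'a dual" where
  "dual_embed x = Dual x 0"

definition dual_unit :: "'a::ring_1 dual" ("\<epsilon>\<^sub>d") where
  "\<epsilon>\<^sub>d = Dual 0 1"

lemma dual_unit_square: "\<epsilon>\<^sub>d * \<epsilon>\<^sub>d = 0"
  by (simp add: dual_unit_def times_dual_def zero_dual_def)

lemma dual_unit_commute: "\<epsilon>\<^sub>d * x = x * \<epsilon>\<^sub>d"
  by (simp add: dual_unit_def times_dual_def)

lemma Dual_eq: "Dual p d = dual_embed p + \<epsilon>\<^sub>d * dual_embed d"
  by (simp add: dual_unit_def dual_embed_def times_dual_def plus_dual_def)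

definition motion_polynomial :: "real poly quat dual \<Rightarrow> bool" where
  "motion_polynomial C \<longleftrightarrow>
     (let P = primal_part C; D = dual_part C in P \<noteq> 0 \<and> P * qcnj D + D * qcnj P = 0)"

text \<open>
  The denominator \<open>P P\<^sup>*\<close> is a scalar, so division by it is multiplication by the inverse
  in \<open>\<real>(t)\<close> of its scalar part. For a motion polynomial, the numerator is vectorial.
\<close>

lemma mult_qcnj_scalar: "A * qcnj A = qscalar (re (A * qcnj A))"
  by (simp add: quat.expand times_quat_def qcnj_def qscalar_def algebra_simps)

definition origin_trajectory :: "real poly quat dual \<Rightarrow> real poly fract quat" where
  "origin_trajectory C =
     (let P = primal_part C; D = dual_part C in
       qscalar (inverse (to_fract (re (P * qcnj P)))) *
         map_quat to_fract (P * qcnj D - D * qcnj P))"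

definition ph_motion :: "real poly \<Rightarrow> real poly quat \<Rightarrow> real poly quat \<Rightarrow> real poly quat dual" where
  "ph_motion \<alpha> b A = (dual_embed (qscalar \<alpha>) + \<epsilon>\<^sub>d * dual_embed b) * dual_embed A"


subsection \<open>Rational PH curves\<close>

lemma fract_deriv_welldefined:
  fixes p q r s :: "real poly"
  assumes "q \<noteq> 0" "s \<noteq> 0" "Fract p q = Fract r s"
  shows "Fract (pderiv p * q - p * pderiv q) (q\<^sup>2) = Fract (pderiv r * s - r * pderiv s) (s\<^sup>2)"
proof -
  from assms have eq: "p * s = r * q" by (simp add: eq_fract)
  then have "pderiv (p * s) = pderiv (r * q)" by simp
  then have d: "pderiv p * s = r * pderiv q + pderiv r * q - p * pderiv s"
    by (simp add: pderiv_mult algebra_simps)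
  have "(pderiv p * q - p * pderiv q) * s\<^sup>2 = (pderiv r * s - r * pderiv s) * q\<^sup>2"
    using d eq by algebra
  then show ?thesis
    using assms by (simp add: eq_fract)
qed

definition fract_deriv :: "real poly fract \<Rightarrow> real poly fract" where
  "fract_deriv f = (THE g. \<exists>p q. q \<noteq> 0 \<and> f = Fract p q \<and>
     g = Fract (pderiv p * q - p * pderiv q) (q\<^sup>2))"

lemma fract_deriv_Fract:
  assumes "q \<noteq> 0"
  shows "fract_deriv (Fract p q) = Fract (pderiv p * q - p * pderiv q) (q\<^sup>2)"
  unfolding fract_deriv_def
proof (rule the_equality)
  show "\<exists>p' q'. q' \<noteq> 0 \<and> Fract p q = Fract p' q' \<and>
      Fract (pderiv p * q - p * pderiv q) (q\<^sup>2) = Fract (pderiv p' * q' - p' * pderiv q') (q'\<^sup>2)"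
    using assms by (intro exI[of _ p] exI[of _ q]) simp
next
  fix g
  assume "\<exists>p' q'. q' \<noteq> 0 \<and> Fract p q = Fract p' q' \<and>
      g = Fract (pderiv p' * q' - p' * pderiv q') (q'\<^sup>2)"
  then show "g = Fract (pderiv p * q - p * pderiv q) (q\<^sup>2)"
    using fract_deriv_welldefined[OF assms] by metis
qed

definition rational_PH_curve :: "real poly fract ^ 3 \<Rightarrow> bool" where
  "rational_PH_curve r \<longleftrightarrow>
     (\<exists>\<sigma>. (fract_deriv (r$1))\<^sup>2 + (fract_deriv (r$2))\<^sup>2 + (fract_deriv (r$3))\<^sup>2 = \<sigma>\<^sup>2)"

definition ph_numerator :: "real poly \<Rightarrow> real poly quat \<Rightarrow> real poly quat" where
  "ph_numerator \<alpha> b = qscalar \<alpha> * qderiv b - qscalar (pderiv \<alpha>) * b"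

definition ph_cond_cross :: "real poly \<Rightarrow> real poly quat \<Rightarrow> real poly quat \<Rightarrow> bool" where
  "ph_cond_cross \<alpha> b A \<longleftrightarrow>
     vcross (qvec (ph_numerator \<alpha> b)) (qvec (A * \<i>\<^sub>q * qcnj A)) = 0"

definition ph_cond_inner :: "real poly \<Rightarrow> real poly quat \<Rightarrow> real poly quat \<Rightarrow> bool" where
  "ph_cond_inner \<alpha> b A \<longleftrightarrow>
     vdot (qvec (ph_numerator \<alpha> b)) (qvec (A * \<j>\<^sub>q * qcnj A)) = 0 \<and>
     vdot (qvec (ph_numerator \<alpha> b)) (qvec (A * \<k>\<^sub>q * qcnj A)) = 0"

definition ph_cond_multiple :: "real poly \<Rightarrow> real poly quat \<Rightarrow> real poly quat \<Rightarrow> bool" where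
  "ph_cond_multiple \<alpha> b A \<longleftrightarrow>
     (\<exists>\<mu>. ph_numerator \<alpha> b = qscalar \<mu> * (A * \<i>\<^sub>q * qcnj A))"

end

theory Submission
  imports
    Defs
    "HOL-Computational_Algebra.Fundamental_Theorem_Algebra"
    "HOL-Computational_Algebra.Field_as_Ring"
begin

text \<open>
  For the equivalence of the conditions, the vectors \<open>A \<i> A\<^sup>*\<close>, \<open>A \<j> A\<^sup>*\<close>, \<open>A \<k> A\<^sup>*\<close> are pairwise
  orthogonal of squared length \<open>(A A\<^sup>*)\<^sup>2\<close>, so only the polynomiality of \<open>\<mu>\<close> is at stake. Writing
  \<open>A = f + \<j> g\<close> with complex polynomials \<open>f, g\<close>, a common root of the components of \<open>A \<i> A\<^sup>*\<close> forces
  a common root \<open>z\<close> of \<open>f\<close> and \<open>g\<close>, hence a right factor \<open>t - z\<close> of \<open>A\<close>. Thus the components of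
  \<open>A \<i> A\<^sup>*\<close> are coprime if \<open>A\<close> is reduced.

  For a PH curve with hodograph proportional to \<open>v\<close>, where \<open>\<langle>v, v\<rangle> = s\<^sup>2\<close>, the half-turn about the
  bisector of \<open>s \<i>\<close> and \<open>v\<close> gives \<open>(v + s \<i>) \<i> (v + s \<i>)\<^sup>* = 2 (s + v\<^sub>1) v\<close>. Cancelling from
  \<open>v + s \<i>\<close> a right factor over \<open>\<langle>1, \<i>\<rangle>\<close> of maximal degree changes this product only by a scalar
  factor and leaves a reduced polynomial.
\<close>

subsection \<open>Quaternion arithmetic\<close>

lemma sel_times_quat [simp]:
  "re (x * y) = re x * re y - im1 x * im1 y - im2 x * im2 y - im3 x * im3 y"
  "im1 (x * y) = re x * im1 y + im1 x * re y + im2 x * im3 y - im3 x * im2 y"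
  "im2 (x * y) = re x * im2 y - im1 x * im3 y + im2 x * re y + im3 x * im1 y"
  "im3 (x * y) = re x * im3 y + im1 x * im2 y - im2 x * im1 y + im3 x * re y"
  by (simp_all add: times_quat_def)

lemma sel_minus_quat [simp]:
  "re (x - y) = re x - re y" "im1 (x - y) = im1 x - im1 y"
  "im2 (x - y) = im2 x - im2 y" "im3 (x - y) = im3 x - im3 y"
  by (simp_all add: minus_quat_def)

lemma sel_one_quat [simp]: "re 1 = 1" "im1 1 = 0" "im2 1 = 0" "im3 1 = 0"
  by (simp_all add: one_quat_def)

lemma sel_qcnj [simp]:
  "re (qcnj x) = re x" "im1 (qcnj x) = - im1 x" "im2 (qcnj x) = - im2 x" "im3 (qcnj x) = - im3 x"
  by (simp_all add: qcnj_def)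

lemma sel_qscalar [simp]:
  "re (qscalar a) = a" "im1 (qscalar a) = 0" "im2 (qscalar a) = 0" "im3 (qscalar a) = 0"
  by (simp_all add: qscalar_def)

lemma sel_quat_units [simp]:
  "re \<i>\<^sub>q = 0" "im1 \<i>\<^sub>q = 1" "im2 \<i>\<^sub>q = 0" "im3 \<i>\<^sub>q = 0"
  "re \<j>\<^sub>q = 0" "im1 \<j>\<^sub>q = 0" "im2 \<j>\<^sub>q = 1" "im3 \<j>\<^sub>q = 0"
  "re \<k>\<^sub>q = 0" "im1 \<k>\<^sub>q = 0" "im2 \<k>\<^sub>q = 0" "im3 \<k>\<^sub>q = 1"
  by (simp_all add: qi_def qj_def qk_def)

lemma sel_qderiv [simp]:
  "re (qderiv A) = pderiv (re A)" "im1 (qderiv A) = pderiv (im1 A)"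
  "im2 (qderiv A) = pderiv (im2 A)" "im3 (qderiv A) = pderiv (im3 A)"
  by (simp_all add: qderiv_def quat.map_sel)

lemma quat_eq_iff:
  "x = y \<longleftrightarrow> re x = re y \<and> im1 x = im1 y \<and> im2 x = im2 y \<and> im3 x = im3 y"
  by (metis quat.expand)

lemma vectorial_iff_re: "vectorial (b :: real poly quat) \<longleftrightarrow> re b = 0"
proof -
  have "re b + re b = 0 \<longleftrightarrow> re b = 0"
    by (metis add_cancel_right_right mult_2 mult_eq_0_iff zero_neq_numeral)
  then show ?thesis by (simp add: vectorial_def quat_eq_iff)
qed

text \<open>The scalar \<open>A * qcnj A\<close>, written as a sum of squares so that positivity
  over the reals applies to it directly.\<close>

definition qnorm :: "'a::comm_ring_1 quat \<Rightarrow> 'a" where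
  "qnorm A = (re A)\<^sup>2 + (im1 A)\<^sup>2 + (im2 A)\<^sup>2 + (im3 A)\<^sup>2"

lemma qnorm_eq: "re (A * qcnj A) = qnorm A"
  by (simp add: qnorm_def power2_eq_square algebra_simps)

lemma qnorm_mult: "qnorm (A * B) = qnorm A * qnorm B"
  by (simp add: qnorm_def power2_eq_square algebra_simps)

text \<open>Evaluation at each real point leaves a vanishing sum of four real squares.\<close>

lemma qnorm_eq_0_iff [simp]: "qnorm (A :: real poly quat) = 0 \<longleftrightarrow> A = 0"
proof
  assume *: "qnorm A = 0"
  have "poly (re A) x = 0 \<and> poly (im1 A) x = 0 \<and> poly (im2 A) x = 0 \<and> poly (im3 A) x = 0" for x
  proof -
    have "poly (qnorm A) x = 0" using * by simp
    then have "(poly (re A) x)\<^sup>2 + (poly (im1 A) x)\<^sup>2 + (poly (im2 A) x)\<^sup>2 + (poly (im3 A) x)\<^sup>2 = 0"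
      by (simp add: qnorm_def)
    then show ?thesis
      by (smt (verit) zero_le_power2 power2_eq_iff zero_power2 power_eq_0_iff)
  qed
  then show "A = 0" by (simp add: quat_eq_iff poly_all_0_iff_0[symmetric])
qed (simp add: qnorm_def)

text \<open>Squares of real leading coefficients are positive, so the top terms cannot
  cancel.\<close>

lemma degree_sum_squares:
  fixes p q :: "real poly"
  assumes "degree (p\<^sup>2 + q\<^sup>2) = 0"
  shows "degree p = 0 \<and> degree q = 0"
proof -
  have *: "degree p = 0 \<and> degree q = 0" if "degree q \<le> degree p" "degree (p\<^sup>2 + q\<^sup>2) = 0" for p q :: "real poly"
  proof (rule ccontr)
    assume "\<not> ?thesis"
    then have n: "degree p > 0" using that(1) by auto
    let ?n = "degree p"
    have "coeff (q * q) (?n + ?n) = coeff q ?n * coeff q ?n"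
    proof (cases "degree q = ?n")
      case True
      then show ?thesis by (metis coeff_mult_degree_sum)
    next
      case False
      then have "degree q < ?n" using that(1) by simp
      moreover have "degree (q * q) < ?n + ?n"
        using degree_mult_le[of q q] calculation by linarith
      ultimately show ?thesis by (simp add: coeff_eq_0)
    qed
    then have "coeff (p\<^sup>2 + q\<^sup>2) (?n + ?n) = (coeff p ?n)\<^sup>2 + (coeff q ?n)\<^sup>2"
      by (simp add: power2_eq_square coeff_mult_degree_sum)
    also have "\<dots> > 0"
      using n by (metis add_pos_nonneg degree_0 leading_coeff_0_iff less_numeral_extra(3)
          zero_le_power2 zero_less_power2)
    finally have "?n + ?n \<le> degree (p\<^sup>2 + q\<^sup>2)" by (intro le_degree) simp
    then show False using that(2) n by simp
  qed
  show ?thesis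
    using *[of q p] *[of p q] assms by (cases "degree q \<le> degree p") (auto simp: add.commute)
qed

text \<open>These components are the classical four-polynomial form of a spatial PH
  hodograph.\<close>

lemma sel_conj_units [simp]:
  fixes A :: "'a::comm_ring_1 quat"
  shows
    "im1 (A * \<i>\<^sub>q * qcnj A) = (re A)\<^sup>2 + (im1 A)\<^sup>2 - (im2 A)\<^sup>2 - (im3 A)\<^sup>2"
    "im2 (A * \<i>\<^sub>q * qcnj A) = 2 * (im1 A * im2 A + re A * im3 A)"
    "im3 (A * \<i>\<^sub>q * qcnj A) = 2 * (im1 A * im3 A - re A * im2 A)"
    "re (A * \<i>\<^sub>q * qcnj A) = 0"
  by (simp_all add: power2_eq_square algebra_simps)

subsection \<open>Conditions on the hodograph\<close>

lemma re_ph_numerator: "vectorial b \<Longrightarrow> re (ph_numerator \<alpha> b) = 0"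
  by (simp add: ph_numerator_def vectorial_iff_re)

lemma vdot_3: "vdot a b = a$1 * b$1 + a$2 * b$2 + a$3 * (b :: 'a::comm_ring_1 ^ 3)$3"
  by (simp add: vdot_def sum_3)

lemma qvec_sel [simp]: "qvec x $ 1 = im1 x" "qvec x $ 2 = im2 x" "qvec x $ 3 = im3 x"
  by (simp_all add: qvec_def)

lemma vcross_eq_0_iff:
  "vcross a b = 0 \<longleftrightarrow> a$2 * b$3 = a$3 * b$2 \<and> a$3 * b$1 = a$1 * b$3 \<and> a$1 * b$2 = a$2 * b$1"
  by (simp add: vcross_def vec_eq_iff forall_3)

text \<open>Over the reals, conjugation by \<open>A\<close> is a rotation scaled by
  \<open>qnorm A\<close>, so the cyclic cross products of the frame are \<open>qnorm A\<close> times
  the third vector. The resulting identities are polynomial and hold over every commutative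
  ring.\<close>

lemma conj_frame_cross:
  fixes A :: "'a::comm_ring_1 quat"
  defines "u \<equiv> A * \<i>\<^sub>q * qcnj A" and "v \<equiv> A * \<j>\<^sub>q * qcnj A" and "w \<equiv> A * \<k>\<^sub>q * qcnj A"
  shows "qnorm A * im1 v = im2 w * im3 u - im3 w * im2 u"
    "qnorm A * im2 v = im3 w * im1 u - im1 w * im3 u"
    "qnorm A * im3 v = im1 w * im2 u - im2 w * im1 u"
    "qnorm A * im1 w = im2 u * im3 v - im3 u * im2 v"
    "qnorm A * im2 w = im3 u * im1 v - im1 u * im3 v"
    "qnorm A * im3 w = im1 u * im2 v - im2 u * im1 v"
  unfolding u_def v_def w_def by (simp_all add: qnorm_def power2_eq_square algebra_simps)

text \<open>The matrix \<open>M\<close> with columns \<open>u\<close>, \<open>v\<close>,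
  \<open>w\<close> satisfies \<open>M M^T = (qnorm A)^2 I\<close>. These relations between its rows
  allow vectors to be expanded in the frame.\<close>

lemma conj_frame_orthogonal:
  fixes A :: "'a::comm_ring_1 quat"
  defines "u \<equiv> A * \<i>\<^sub>q * qcnj A" and "v \<equiv> A * \<j>\<^sub>q * qcnj A" and "w \<equiv> A * \<k>\<^sub>q * qcnj A"
  shows "im1 u * im1 u + im1 v * im1 v + im1 w * im1 w = (qnorm A)\<^sup>2"
    "im2 u * im2 u + im2 v * im2 v + im2 w * im2 w = (qnorm A)\<^sup>2"
    "im3 u * im3 u + im3 v * im3 v + im3 w * im3 w = (qnorm A)\<^sup>2"
    "im1 u * im2 u + im1 v * im2 v + im1 w * im2 w = 0"
    "im1 u * im3 u + im1 v * im3 v + im1 w * im3 w = 0"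
    "im2 u * im3 u + im2 v * im3 v + im2 w * im3 w = 0"
  unfolding u_def v_def w_def by (simp_all add: qnorm_def power2_eq_square algebra_simps)

text \<open>Triple product: \<open>qnorm A * v\<close> is \<open>w \<times> u\<close>, so its scalar
  product with \<open>x\<close> is minus that of \<open>w\<close> with \<open>x \<times> u\<close>;
  similarly for \<open>w\<close>. The factor \<open>qnorm A\<close> stays because the ring may have
  zero divisors.\<close>

lemma vdot_mult_qnorm:
  fixes x A :: "'a::comm_ring_1 quat"
  assumes "vcross (qvec x) (qvec (A * \<i>\<^sub>q * qcnj A)) = 0"
  shows "qnorm A * vdot (qvec x) (qvec (A * \<j>\<^sub>q * qcnj A)) = 0"
    and "qnorm A * vdot (qvec x) (qvec (A * \<k>\<^sub>q * qcnj A)) = 0"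
proof -
  define u v w where "u = A * \<i>\<^sub>q * qcnj A" "v = A * \<j>\<^sub>q * qcnj A" "w = A * \<k>\<^sub>q * qcnj A"
  have c: "im2 x * im3 u - im3 x * im2 u = 0" "im3 x * im1 u - im1 x * im3 u = 0"
    "im1 x * im2 u - im2 x * im1 u = 0"
    using assms by (simp_all add: vcross_eq_0_iff u_v_w_def del: sel_times_quat sel_conj_units)
  note f = conj_frame_cross[of A, folded u_v_w_def]
  have "qnorm A * vdot (qvec x) (qvec v) =
      im1 x * (qnorm A * im1 v) + im2 x * (qnorm A * im2 v) + im3 x * (qnorm A * im3 v)"
    by (simp add: vdot_3 algebra_simps)
  also have "\<dots> = - (im1 w * (im2 x * im3 u - im3 x * im2 u) + im2 w * (im3 x * im1 u - im1 x * im3 u)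
      + im3 w * (im1 x * im2 u - im2 x * im1 u))"
    unfolding f by (simp add: algebra_simps)
  also have "\<dots> = 0" unfolding c by simp
  finally show "qnorm A * vdot (qvec x) (qvec (A * \<j>\<^sub>q * qcnj A)) = 0"
    unfolding u_v_w_def .
  have "qnorm A * vdot (qvec x) (qvec w) =
      im1 x * (qnorm A * im1 w) + im2 x * (qnorm A * im2 w) + im3 x * (qnorm A * im3 w)"
    by (simp add: vdot_3 algebra_simps)
  also have "\<dots> = im1 v * (im2 x * im3 u - im3 x * im2 u) + im2 v * (im3 x * im1 u - im1 x * im3 u)
      + im3 v * (im1 x * im2 u - im2 x * im1 u)"
    unfolding f by (simp add: algebra_simps)
  also have "\<dots> = 0" unfolding c by simp
  finally show "qnorm A * vdot (qvec x) (qvec (A * \<k>\<^sub>q * qcnj A)) = 0"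
    unfolding u_v_w_def .
qed

text \<open>In the expansion of \<open>(qnorm A)\<^sup>2 x\<close> along \<open>u\<close>,
  \<open>v\<close>, \<open>w\<close>, only the \<open>u\<close> term survives.\<close>

lemma orthogonal_expansion:
  fixes x A :: "'a::comm_ring_1 quat"
  assumes "vdot (qvec x) (qvec (A * \<j>\<^sub>q * qcnj A)) = 0"
    and "vdot (qvec x) (qvec (A * \<k>\<^sub>q * qcnj A)) = 0"
  defines "u \<equiv> A * \<i>\<^sub>q * qcnj A"
  defines "s \<equiv> vdot (qvec x) (qvec u)"
  shows "(qnorm A)\<^sup>2 * im1 x = s * im1 u" "(qnorm A)\<^sup>2 * im2 x = s * im2 u"
    "(qnorm A)\<^sup>2 * im3 x = s * im3 u"
proof -
  define v w where "v = A * \<j>\<^sub>q * qcnj A" "w = A * \<k>\<^sub>q * qcnj A"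
  define N where "N = (qnorm A)\<^sup>2"
  note o = conj_frame_orthogonal[of A, folded u_def v_w_def N_def]
  have d: "vdot (qvec x) (qvec v) = 0" "vdot (qvec x) (qvec w) = 0"
    using assms(1,2) by (simp_all only: v_w_def)
  \<comment> \<open>With a row of the frame matrix for \<open>y\<close>, \<open>y'\<close>,
    \<open>y''\<close>, the right side collapses to \<open>N\<close> times one component of
    \<open>x\<close>.\<close>
  have sum: "s * y + vdot (qvec x) (qvec v) * y' + vdot (qvec x) (qvec w) * y'' =
      (im1 u * y + im1 v * y' + im1 w * y'') * im1 x + (im2 u * y + im2 v * y' + im2 w * y'') * im2 x
      + (im3 u * y + im3 v * y' + im3 w * y'') * im3 x" for y y' y''
    by (simp add: s_def vdot_3 algebra_simps)
  have o': "im2 u * im1 u + im2 v * im1 v + im2 w * im1 w = 0"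
    "im3 u * im1 u + im3 v * im1 v + im3 w * im1 w = 0"
    "im3 u * im2 u + im3 v * im2 v + im3 w * im2 w = 0"
    using o by (simp_all only: mult.commute)
  show "(qnorm A)\<^sup>2 * im1 x = s * im1 u"
    using sum[of "im1 u" "im1 v" "im1 w"] unfolding o o' d N_def by simp
  show "(qnorm A)\<^sup>2 * im2 x = s * im2 u"
    using sum[of "im2 u" "im2 v" "im2 w"] unfolding o o' d N_def by simp
  show "(qnorm A)\<^sup>2 * im3 x = s * im3 u"
    using sum[of "im3 u" "im3 v" "im3 w"] unfolding o o' d N_def by simp
qed

subsection \<open>Reduced polynomials\<close>

lemma map_poly_Re_Im_mult:
  "map_poly Re (p * q) = map_poly Re p * map_poly Re q - map_poly Im p * map_poly Im q"
  "map_poly Im (p * q) = map_poly Re p * map_poly Im q + map_poly Im p * map_poly Re q"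
  by (intro poly_eqI; simp add: coeff_map_poly coeff_mult sum_subtractf sum.distrib)+

text \<open>The factor \<open>t - z\<close> is split off \<open>a + \<i> b\<close> over the complex
  numbers; \<open>c\<close> and \<open>d\<close> are the real and imaginary parts of the
  cofactor.\<close>

lemma complex_root_factor:
  fixes a b :: "real poly"
  assumes "poly (map_poly of_real a) z + \<i> * poly (map_poly of_real b) z = 0"
  obtains c d where "a = [:- Re z, 1:] * c - [:- Im z:] * d" "b = [:- Re z, 1:] * d + [:- Im z:] * c"
proof -
  define F where "F = map_poly of_real a + smult \<i> (map_poly of_real b)"
  have "poly F z = 0" using assms by (simp add: F_def)
  then obtain H where H: "F = [:- z, 1:] * H"
    by (metis poly_eq_0_iff_dvd dvdE)
  have "a = map_poly Re F" "b = map_poly Im F"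
    by (simp_all add: F_def poly_eq_iff coeff_map_poly)
  moreover have "map_poly Re [:- z, 1:] = [:- Re z, 1:]" "map_poly Im [:- z, 1:] = [:- Im z:]"
    by (simp_all add: map_poly_pCons)
  ultimately show thesis
    using that[of "map_poly Re H" "map_poly Im H"] unfolding H map_poly_Re_Im_mult by simp
qed

lemma qdegree_pos_iff: "qdegree A > 0 \<longleftrightarrow> (\<exists>n>0. qcoeff A n \<noteq> (0 :: 'a::comm_ring_1 quat))"
proof -
  \<comment> \<open>Some bound must exist before the \<open>LEAST\<close> in \<open>qdegree\<close>
    is known to be a bound itself.\<close>
  obtain N where "\<forall>i>N. qcoeff A i = 0"
  proof
    show "\<forall>i>max (max (degree (re A)) (degree (im1 A))) (max (degree (im2 A)) (degree (im3 A))). qcoeff A i = 0"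
      by (auto simp: quat_eq_iff coeff_eq_0)
  qed
  then have L: "\<forall>i>qdegree A. qcoeff A i = 0"
    unfolding qdegree_def by (rule LeastI)
  show ?thesis
  proof
    assume *: "qdegree A > 0"
    show "\<exists>n>0. qcoeff A n \<noteq> 0"
    proof (rule ccontr)
      assume "\<not> ?thesis"
      then have "qdegree A \<le> 0" unfolding qdegree_def by (intro Least_le) blast
      then show False using * by simp
    qed
  qed (use L in \<open>metis gr0I\<close>)
qed

text \<open>The copy of the complex polynomials spanned by \<open>1\<close> and \<open>\<i>\<close>;
  two vanishing components replace the coefficientwise condition on right factors.\<close>

definition complex_quat :: "real poly quat \<Rightarrow> bool" where
  "complex_quat G \<longleftrightarrow> im2 G = 0 \<and> im3 G = 0"

lemma complex_quat_iff:
  "complex_quat G \<longleftrightarrow> (\<forall>n. \<exists>x y. qcoeff G n = qscalar x + qscalar y * \<i>\<^sub>q)"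
  by (auto simp: complex_quat_def quat_eq_iff poly_eq_iff)

lemma complex_quat_mult: "complex_quat G \<Longrightarrow> complex_quat H \<Longrightarrow> complex_quat (G * H)"
  by (simp add: complex_quat_def)

lemma degree_qnorm_complex_quat:
  assumes "complex_quat G" "qdegree G > 0"
  shows "degree (qnorm G) > 0"
proof (rule ccontr)
  assume "\<not> ?thesis"
  then have "degree (re G) = 0 \<and> degree (im1 G) = 0"
    using assms by (intro degree_sum_squares) (simp add: qnorm_def complex_quat_def)
  then have "\<forall>n>0. qcoeff G n = 0"
    using assms(1) by (auto simp: quat_eq_iff complex_quat_def coeff_eq_0)
  then show False using assms(2) qdegree_pos_iff by blast
qed

text \<open>A real factor of positive degree is central, so it is also a right factor.\<close>

lemma reduced_wrt_i_iff:
  "reduced_wrt_i A \<longleftrightarrow> (\<nexists>B G. qdegree G > 0 \<and> complex_quat G \<and> A = B * G)"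
proof -
  have "\<exists>B G. qdegree G > 0 \<and> complex_quat G \<and> A = B * G" if "degree p > 0" "A = qscalar p * B" for p B
  proof (intro exI conjI)
    show "A = B * qscalar p" by (simp add: that(2) quat_eq_iff mult.commute)
    have "coeff p (degree p) \<noteq> 0" using that(1) by auto
    then show "qdegree (qscalar p) > 0"
      using that(1) by (auto simp: qdegree_pos_iff quat_eq_iff)
    show "complex_quat (qscalar p)" by (simp add: complex_quat_def)
  qed
  then show ?thesis unfolding reduced_wrt_i_def complex_quat_iff[symmetric] by blast
qed

text \<open>Right factors are split off as long as possible. As \<open>qnorm\<close> is
  multiplicative, each factor of positive degree lowers the degree of the norm, and the factors
  removed multiply to a single complex one.\<close>

lemma reduced_factorization:
  assumes "A \<noteq> 0"
  obtains B G where "reduced_wrt_i B" "complex_quat G" "A = B * G"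
proof -
  have "\<exists>B G. reduced_wrt_i B \<and> complex_quat G \<and> A = B * G"
    using assms
  proof (induction "degree (qnorm A)" arbitrary: A rule: less_induct)
    case less
    show ?case
    proof (cases "reduced_wrt_i A")
      case True
      then show ?thesis by (intro exI[of _ A] exI[of _ 1]) (simp add: complex_quat_def)
    next
      case False
      then obtain B G where BG: "qdegree G > 0" "complex_quat G" "A = B * G"
        by (auto simp: reduced_wrt_i_iff)
      have "B \<noteq> 0" "G \<noteq> 0" using less.prems BG by auto
      then have "degree (qnorm A) = degree (qnorm B) + degree (qnorm G)"
        unfolding BG(3) qnorm_mult by (simp add: degree_mult_eq)
      then have "degree (qnorm B) < degree (qnorm A)"
        using degree_qnorm_complex_quat[OF BG(2,1)] by simp
      then obtain B' G' where "reduced_wrt_i B'" "complex_quat G'" "B = B' * G'"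
        using less.hyps \<open>B \<noteq> 0\<close> by blast
      then show ?thesis using BG complex_quat_mult by (metis mult.assoc)
    qed
  qed
  then show thesis using that by blast
qed

lemma reduced_wrt_i_one: "reduced_wrt_i 1"
  unfolding reduced_wrt_i_iff
proof clarify
  fix B G assume G: "qdegree G > 0" "complex_quat G" "1 = B * G"
  then have "B \<noteq> 0" "G \<noteq> 0" by auto
  then have "degree (qnorm (B * G)) = degree (qnorm B) + degree (qnorm G)"
    unfolding qnorm_mult by (simp add: degree_mult_eq)
  moreover have "degree (qnorm (B * G)) = 0" by (simp flip: G(3) add: qnorm_def)
  ultimately show False using degree_qnorm_complex_quat[OF G(2,1)] by simp
qed

text \<open>For \<open>f = re A + \<i> im1 A\<close> and \<open>g = im2 A - \<i> im3 A\<close> one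
  has \<open>A = f + \<j> g\<close>. A common root \<open>z\<close> of \<open>f\<close> and
  \<open>g\<close> would give the right factor \<open>t - z\<close>.\<close>

lemma reduced_no_root:
  fixes A :: "real poly quat"
  assumes "reduced_wrt_i A"
  defines "h z p \<equiv> poly (map_poly complex_of_real p) z"
  shows "\<not> (h z (re A) + \<i> * h z (im1 A) = 0 \<and> h z (im2 A) - \<i> * h z (im3 A) = 0)"
proof
  assume *: "h z (re A) + \<i> * h z (im1 A) = 0 \<and> h z (im2 A) - \<i> * h z (im3 A) = 0"
  obtain a b where ab: "re A = [:- Re z, 1:] * a - [:- Im z:] * b" "im1 A = [:- Re z, 1:] * b + [:- Im z:] * a"
    using complex_root_factor[of "re A" z "im1 A"] * unfolding h_def by blast
  \<comment> \<open>The imaginary part of \<open>g\<close> is \<open>- im3 A\<close> because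
    \<open>\<j> \<i> = - \<k>\<close>.\<close>
  have "map_poly complex_of_real (- im3 A) = - map_poly complex_of_real (im3 A)"
    by (simp add: poly_eq_iff coeff_map_poly)
  then obtain c d where cd: "im2 A = [:- Re z, 1:] * c - [:- Im z:] * d" "- im3 A = [:- Re z, 1:] * d + [:- Im z:] * c"
    using complex_root_factor[of "im2 A" z "- im3 A"] * unfolding h_def by auto
  have im3: "im3 A = [:- Re z, 1:] * (- d) - [:- Im z:] * c"
    using arg_cong[OF cd(2), of uminus] unfolding minus_minus mult_minus_right by simp
  let ?G = "Quat [:- Re z, 1:] [:- Im z:] 0 0"
  have "A = Quat a b c (- d) * ?G"
    using ab cd(1) im3 by (simp add: quat_eq_iff algebra_simps)
  moreover have "qdegree ?G > 0"
    unfolding qdegree_pos_iff by (intro exI[of _ 1]) (simp add: quat_eq_iff)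
  moreover have "complex_quat ?G" by (simp add: complex_quat_def)
  ultimately show False
    using assms(1) unfolding reduced_wrt_i_iff by blast
qed

section \<open>Coprimality of the components of \<open>A \<i> A\<^sup>*\<close>\<close>

lemma map_poly_of_real_mult:
  "map_poly complex_of_real (p * q) = map_poly of_real p * map_poly of_real q"
  by (intro poly_eqI) (simp add: coeff_map_poly coeff_mult)

lemma map_poly_of_real_add:
  "map_poly complex_of_real (p + q) = map_poly of_real p + map_poly of_real q"
  "map_poly complex_of_real (p - q) = map_poly of_real p - map_poly of_real q"
  by (intro poly_eqI; simp add: coeff_map_poly)+

lemma poly_of_real_cnj:
  "poly (map_poly complex_of_real p) (cnj z) = cnj (poly (map_poly complex_of_real p) z)"
  by (induction p) (simp_all add: map_poly_pCons)

text \<open>Let \<open>f = a + \<i> b\<close>, \<open>g = c - \<i> d\<close>,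
  \<open>f' = a - \<i> b\<close>, \<open>g' = c + \<i> d\<close> be the values at \<open>z\<close>.
  A common root means \<open>f f' = g g'\<close>, \<open>f' g = 0\<close> and
  \<open>f g' = 0\<close>, which forces \<open>f = g = 0\<close> or
  \<open>f' = g' = 0\<close>.\<close>

lemma reduced_conj_i_no_root:
  assumes "reduced_wrt_i A"
  defines "u \<equiv> A * \<i>\<^sub>q * qcnj A"
  shows "\<not> (poly (map_poly complex_of_real (im1 u)) z = 0 \<and>
    poly (map_poly complex_of_real (im2 u)) z = 0 \<and> poly (map_poly complex_of_real (im3 u)) z = 0)"
proof
  define h where "h p = poly (map_poly complex_of_real p) z" for p
  define a b c d where "a = h (re A)" "b = h (im1 A)" "c = h (im2 A)" "d = h (im3 A)"
  have h2: "h (2 * p) = 2 * h p" for p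
    by (simp only: h_def mult_2 map_poly_of_real_add poly_add)
  assume "poly (map_poly complex_of_real (im1 u)) z = 0 \<and>
    poly (map_poly complex_of_real (im2 u)) z = 0 \<and> poly (map_poly complex_of_real (im3 u)) z = 0"
  then have "h (im1 u) = 0" "h (im2 u) = 0" "h (im3 u) = 0" by (simp_all add: h_def)
  then have "h ((re A)\<^sup>2 + (im1 A)\<^sup>2 - (im2 A)\<^sup>2 - (im3 A)\<^sup>2) = 0"
    "h (im1 A * im2 A + re A * im3 A) = 0" "h (im1 A * im3 A - re A * im2 A) = 0"
    unfolding u_def sel_conj_units h2 by simp_all
  then have r: "a\<^sup>2 + b\<^sup>2 - c\<^sup>2 - d\<^sup>2 = 0" "b * c + a * d = 0" "b * d - a * c = 0"
    by (simp_all add: h_def a_b_c_d_def map_poly_of_real_add map_poly_of_real_mult power2_eq_square)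
  have "\<not> (a + \<i> * b = 0 \<and> c - \<i> * d = 0)"
    using reduced_no_root[OF assms(1), of z] by (simp add: a_b_c_d_def h_def)
  \<comment> \<open>Since \<open>A\<close> has real components, conjugation turns this case into a
    common root of the two complex polynomials at \<open>cnj z\<close>.\<close>
  moreover have "\<not> (a - \<i> * b = 0 \<and> c + \<i> * d = 0)"
  proof
    assume "a - \<i> * b = 0 \<and> c + \<i> * d = 0"
    then have "cnj (a - \<i> * b) = 0" "cnj (c + \<i> * d) = 0" by auto
    then show False
      using reduced_no_root[OF assms(1), of "cnj z"]
      by (simp add: a_b_c_d_def h_def poly_of_real_cnj)
  qed
  moreover have "(a + \<i> * b) * (a - \<i> * b) = (c - \<i> * d) * (c + \<i> * d)"
  proof -
    have "(a + \<i> * b) * (a - \<i> * b) = a\<^sup>2 + b\<^sup>2" "(c - \<i> * d) * (c + \<i> * d) = c\<^sup>2 + d\<^sup>2"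
      by (simp_all add: power2_eq_square algebra_simps)
    then show ?thesis using r(1) by (simp add: algebra_simps)
  qed
  moreover have "(a - \<i> * b) * (c - \<i> * d) = 0"
  proof -
    have "(a - \<i> * b) * (c - \<i> * d) = - (b * d - a * c) - \<i> * (b * c + a * d)"
      by (simp add: algebra_simps)
    then show ?thesis using r by simp
  qed
  moreover have "(a + \<i> * b) * (c + \<i> * d) = 0"
  proof -
    have "(a + \<i> * b) * (c + \<i> * d) = - (b * d - a * c) + \<i> * (b * c + a * d)"
      by (simp add: algebra_simps)
    then show ?thesis using r by simp
  qed
  ultimately show False by (metis mult_eq_0_iff)
qed

text \<open>A nonconstant gcd would have a complex root, which would be common to all three
  components.\<close>

lemma reduced_conj_i_coprime:
  assumes "reduced_wrt_i A"
  defines "u \<equiv> A * \<i>\<^sub>q * qcnj A"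
  shows "is_unit (gcd (im1 u) (gcd (im2 u) (im3 u)))"
proof -
  define g where "g = gcd (im1 u) (gcd (im2 u) (im3 u))"
  have root: "poly (map_poly complex_of_real p) z = 0"
    if "g dvd p" "poly (map_poly complex_of_real g) z = 0" for z p
    using that by (auto elim!: dvdE simp: map_poly_of_real_mult)
  have "g dvd im1 u" "g dvd im2 u" "g dvd im3 u"
    by (auto simp: g_def intro: dvd_trans[OF gcd_dvd2])
  then have no_root: "poly (map_poly complex_of_real g) z \<noteq> 0" for z
    using reduced_conj_i_no_root[OF assms(1), of z, folded u_def] root by blast
  then have "constant (poly (map_poly complex_of_real g))"
    using fundamental_theorem_of_algebra by blast
  then have "degree g = 0"
    by (simp add: constant_degree degree_map_poly)
  moreover have "g \<noteq> 0" using no_root[of 0] by auto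
  ultimately show ?thesis unfolding g_def[symmetric] by (simp add: is_unit_iff_degree)
qed

lemma dvd_mult_gcd:
  fixes n :: "'a::semiring_gcd"
  assumes "n dvd s * a" "n dvd s * b"
  shows "n dvd s * gcd a b"
proof -
  have "n dvd gcd (s * a) (s * b)" using assms by (rule gcd_greatest)
  then show ?thesis by (simp add: gcd_mult_left)
qed

section \<open>Equivalence of the three conditions\<close>

lemma ph_cond_multiple_imp_cross: "ph_cond_multiple \<alpha> b A \<Longrightarrow> ph_cond_cross \<alpha> b A"
  by (auto simp: ph_cond_multiple_def ph_cond_cross_def vcross_eq_0_iff simp del: sel_conj_units)

lemma ph_cond_cross_imp_inner:
  assumes "A \<noteq> 0" "ph_cond_cross \<alpha> b A"
  shows "ph_cond_inner \<alpha> b A"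
  using vdot_mult_qnorm[OF assms(2)[unfolded ph_cond_cross_def]] assms(1)
  by (simp add: ph_cond_inner_def del: sel_times_quat)

text \<open>The expansion in the frame gives \<open>N v = s u\<close>, so the multiplier is at first
  only the fraction \<open>s / N\<close>. Coprimality of the components of \<open>u\<close> makes it
  a polynomial.\<close>

lemma ph_cond_inner_imp_multiple:
  assumes "vectorial b" "reduced_wrt_i A" "ph_cond_inner \<alpha> b A"
  shows "ph_cond_multiple \<alpha> b A"
proof -
  define v where "v = ph_numerator \<alpha> b"
  define u where "u = A * \<i>\<^sub>q * qcnj A"
  define N where "N = (qnorm A)\<^sup>2"
  define s where "s = vdot (qvec v) (qvec u)"
  have N: "N \<noteq> 0" using reduced_wrt_i_nonzero[OF assms(2)] by (simp add: N_def)
  have e: "N * im1 v = s * im1 u" "N * im2 v = s * im2 u" "N * im3 v = s * im3 u"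
    using orthogonal_expansion[of v A] assms(3)
    unfolding ph_cond_inner_def v_def u_def s_def N_def by blast+
  then have "N dvd s * im1 u" "N dvd s * im2 u" "N dvd s * im3 u" by (metis dvd_triv_left)+
  then have "N dvd s * gcd (im1 u) (gcd (im2 u) (im3 u))"
    by (intro dvd_mult_gcd)
  then have "N dvd s"
    using reduced_conj_i_coprime[OF assms(2), folded u_def] dvd_mult_unit_iff by blast
  then obtain m where "s = N * m" ..
  with e N have "im1 v = m * im1 u" "im2 v = m * im2 u" "im3 v = m * im3 u"
    by (simp_all add: mult.assoc)
  moreover have "re v = 0" "re u = 0"
    using re_ph_numerator[OF assms(1)] unfolding v_def u_def by simp_all
  ultimately have "v = qscalar m * u" by (simp add: quat_eq_iff)
  then show ?thesis unfolding ph_cond_multiple_def v_def u_def by blast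
qed

subsection \<open>Trajectories\<close>

lemma ph_motion_parts [simp]:
  "primal_part (ph_motion \<alpha> b A) = qscalar \<alpha> * A" "dual_part (ph_motion \<alpha> b A) = b * A"
  by (simp_all add: ph_motion_def dual_embed_def dual_unit_def times_dual_def plus_dual_def)

lemma to_fract_2: "to_fract (2 :: 'a::idom) = 2"
  by (metis one_add_one to_fract_1 to_fract_add)

text \<open>Both rest on \<open>qcnj b = - b\<close> and the centrality of
  \<open>A * qcnj A\<close>. The sum of the products vanishes, which is the motion polynomial
  condition; their difference is the numerator of the trajectory.\<close>

lemma ph_motion_products:
  fixes A b :: "real poly quat"
  assumes "vectorial b"
  shows "qscalar \<alpha> * A * qcnj (b * A) = - qscalar (\<alpha> * qnorm A) * b"
    and "b * A * qcnj (qscalar \<alpha> * A) = qscalar (\<alpha> * qnorm A) * b"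
  using assms unfolding vectorial_iff_re
  by (simp_all add: quat_eq_iff uminus_quat_def qnorm_def power2_eq_square algebra_simps)

lemma motion_polynomial_ph_motion:
  assumes "\<alpha> \<noteq> 0" "vectorial b" "A \<noteq> 0"
  shows "motion_polynomial (ph_motion \<alpha> b A)"
proof -
  have "qscalar \<alpha> * A \<noteq> 0" using assms(1,3) by (auto simp: quat_eq_iff)
  then show ?thesis
    using assms(2) by (simp add: motion_polynomial_def ph_motion_products)
qed

lemma origin_trajectory_ph_motion:
  assumes "\<alpha> \<noteq> 0" "vectorial b" "A \<noteq> 0"
  shows "origin_trajectory (ph_motion \<alpha> b A) =
    qscalar (- 2 * inverse (to_fract \<alpha>)) * map_quat to_fract b"
proof -
  define N where "N = qnorm A"
  have N: "N \<noteq> 0" using assms by (simp add: N_def)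
  have d: "re (qscalar \<alpha> * A * qcnj (qscalar \<alpha> * A)) = \<alpha>\<^sup>2 * N"
    unfolding qnorm_eq qnorm_mult N_def by (simp add: qnorm_def)
  have n: "qscalar \<alpha> * A * qcnj (b * A) - b * A * qcnj (qscalar \<alpha> * A) = qscalar (- 2 * \<alpha> * N) * b"
    unfolding ph_motion_products[OF assms(2)] N_def[symmetric]
    by (simp add: quat_eq_iff uminus_quat_def algebra_simps)
  have "inverse (to_fract (\<alpha>\<^sup>2 * N)) * to_fract (- 2 * \<alpha> * N * p) = - 2 * inverse (to_fract \<alpha>) * to_fract p" for p
  proof -
    show ?thesis
      using assms(1) N by (simp add: to_fract_2 power2_eq_square field_simps)
  qed
  then show ?thesis
    unfolding origin_trajectory_def Let_def ph_motion_parts d n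
    by (simp add: quat_eq_iff quat.map_sel del: mult_minus_left)
qed

text \<open>The derivative of the curve is \<open>- 2 n / \<alpha>^2\<close>, so its squared length
  is a square in \<real>(t) exactly if that of \<open>n\<close> is. The square root remains a
  fraction \<open>p / q\<close>, whose denominator is later absorbed by scaling the
  hodograph.\<close>

lemma rational_PH_curve_iff:
  fixes b :: "real poly quat"
  assumes "\<alpha> \<noteq> 0"
  defines "n \<equiv> ph_numerator \<alpha> b"
  shows "rational_PH_curve (qvec (qscalar (- 2 * inverse (to_fract \<alpha>)) * map_quat to_fract b)) \<longleftrightarrow>
    (\<exists>p q. q \<noteq> 0 \<and> q\<^sup>2 * ((im1 n)\<^sup>2 + (im2 n)\<^sup>2 + (im3 n)\<^sup>2) = p\<^sup>2)"
  (is "rational_PH_curve ?r \<longleftrightarrow> _")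
proof -
  define S where "S = (im1 n)\<^sup>2 + (im2 n)\<^sup>2 + (im3 n)\<^sup>2"
  have r: "- 2 * inverse (to_fract \<alpha>) * to_fract p = Fract (- 2 * p) \<alpha>" for p
  proof -
    show ?thesis by (simp add: Fract_conv_to_fract to_fract_2 divide_inverse)
  qed
  have d: "fract_deriv (Fract (- 2 * p) \<alpha>) = Fract (- 2 * (\<alpha> * pderiv p - pderiv \<alpha> * p)) (\<alpha>\<^sup>2)" for p
    unfolding fract_deriv_Fract[OF assms(1)]
    by (simp add: pderiv_mult pderiv_minus pderiv_numeral algebra_simps)
  have "(fract_deriv (?r$1))\<^sup>2 + (fract_deriv (?r$2))\<^sup>2 + (fract_deriv (?r$3))\<^sup>2 = Fract (4 * S) (\<alpha>^4)"
  proof -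
    have "fract_deriv (?r$1) = Fract (- 2 * im1 n) (\<alpha>\<^sup>2)" "fract_deriv (?r$2) = Fract (- 2 * im2 n) (\<alpha>\<^sup>2)"
      "fract_deriv (?r$3) = Fract (- 2 * im3 n) (\<alpha>\<^sup>2)"
      using r d by (simp_all add: quat.map_sel n_def ph_numerator_def)
    then show ?thesis
      using assms(1) by (simp add: S_def power2_eq_square power4_eq_xxxx eq_fract algebra_simps)
  qed
  then have *: "rational_PH_curve ?r \<longleftrightarrow> (\<exists>\<sigma>. Fract (4 * S) (\<alpha>^4) = \<sigma>\<^sup>2)"
    by (simp add: rational_PH_curve_def)
  also have "\<dots> \<longleftrightarrow> (\<exists>p q. q \<noteq> 0 \<and> q\<^sup>2 * S = p\<^sup>2)"
  proof safe
    fix \<sigma> assume a: "Fract (4 * S) (\<alpha>^4) = \<sigma>\<^sup>2"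
    obtain p q where pq: "\<sigma> = Fract p q" "q \<noteq> 0" by (cases \<sigma>) auto
    then have "4 * S * q\<^sup>2 = p\<^sup>2 * \<alpha>^4"
      using a assms(1) by (simp add: power2_eq_square eq_fract)
    then have "(2 * q)\<^sup>2 * S = (p * \<alpha>\<^sup>2)\<^sup>2"
      by (simp add: power2_eq_square power4_eq_xxxx algebra_simps)
    then show "\<exists>p q. q \<noteq> 0 \<and> q\<^sup>2 * S = p\<^sup>2" using pq(2) by (metis mult_eq_0_iff zero_neq_numeral)
  next
    fix p q assume a: "q \<noteq> 0" "q\<^sup>2 * S = p\<^sup>2"
    have "4 * S * (q * \<alpha>\<^sup>2)\<^sup>2 = 4 * (q\<^sup>2 * S) * \<alpha>^4"
      by (simp add: power2_eq_square power4_eq_xxxx algebra_simps)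
    also have "\<dots> = (2 * p)\<^sup>2 * \<alpha>^4"
      unfolding a(2) by (simp add: power2_eq_square)
    finally have "4 * S * (q * \<alpha>\<^sup>2)\<^sup>2 = (2 * p)\<^sup>2 * \<alpha>^4" .
    then have "Fract (4 * S) (\<alpha>^4) = (Fract (2 * p) (q * \<alpha>\<^sup>2))\<^sup>2"
      using a(1) assms(1) by (simp add: power2_eq_square eq_fract)
    then show "\<exists>\<sigma>. Fract (4 * S) (\<alpha>^4) = \<sigma>\<^sup>2" by blast
  qed
  finally show ?thesis unfolding S_def .
qed

lemma common_denominator:
  fixes r :: "real poly fract ^ 3"
  obtains \<alpha> b where "\<alpha> \<noteq> 0" "vectorial b"
    "r = qvec (qscalar (- 2 * inverse (to_fract \<alpha>)) * map_quat to_fract b)"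
proof -
  have frac: "\<exists>p q. q \<noteq> 0 \<and> x = to_fract p / to_fract q" for x :: "real poly fract"
    by (cases x) (auto simp: to_fract_def)
  obtain p1 q1 p2 q2 p3 q3 where r:
    "q1 \<noteq> 0" "r$1 = to_fract p1 / to_fract q1" "q2 \<noteq> 0" "r$2 = to_fract p2 / to_fract q2"
    "q3 \<noteq> 0" "r$3 = to_fract p3 / to_fract q3"
    using frac by metis
  let ?b = "Quat 0 (p1 * q2 * q3) (p2 * q1 * q3) (p3 * q1 * q2)"
  \<comment> \<open>The factor \<open>- 2\<close> cancels the one in the trajectory formula.\<close>
  let ?\<alpha> = "- 2 * q1 * q2 * q3"
  have "r = qvec (qscalar (- 2 * inverse (to_fract ?\<alpha>)) * map_quat to_fract ?b)"
    using r by (simp add: to_fract_2 vec_eq_iff forall_3 quat.map_sel field_simps)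
  then show thesis
    using r by (intro that[of ?\<alpha> ?b]) (simp_all add: vectorial_iff_re)
qed

section \<open>Construction of \<open>A\<close> from the hodograph\<close>

lemma qcnj_mult: "qcnj (A * B) = qcnj B * qcnj A"
  by (simp add: quat_eq_iff algebra_simps)

lemma qscalar_commute: "qscalar a * A = A * qscalar a"
  by (simp add: quat_eq_iff mult.commute)

lemma qscalar_mult: "qscalar a * qscalar b = qscalar (a * b)"
  by (simp add: quat_eq_iff)

text \<open>\<open>G\<close> commutes with \<open>\<i>\<close>, so \<open>G \<i> G\<^sup>*\<close>
  is \<open>\<i>\<close> times the central scalar \<open>qnorm G\<close>.\<close>

lemma conj_i_mult_complex_quat:
  assumes "complex_quat G"
  shows "B * G * \<i>\<^sub>q * qcnj (B * G) = qscalar (qnorm G) * (B * \<i>\<^sub>q * qcnj B)"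
proof -
  have "G * \<i>\<^sub>q * qcnj G = qscalar (qnorm G) * \<i>\<^sub>q"
    using assms by (simp add: complex_quat_def quat_eq_iff qnorm_def power2_eq_square)
  then have "B * G * \<i>\<^sub>q * qcnj (B * G) = B * qscalar (qnorm G) * \<i>\<^sub>q * qcnj B"
    by (metis (no_types) mult.assoc qcnj_mult)
  then show ?thesis by (simp only: qscalar_commute[symmetric] mult.assoc)
qed

text \<open>For vectorial \<open>C\<close>, \<open>C \<i> C\<^sup>*\<close> equals
  \<open>2 \<langle>C, \<i>\<rangle> C - \<langle>C, C\<rangle> \<i>\<close>. If
  \<open>C = v + s \<i>\<close>, then \<open>\<langle>C, C\<rangle> = 2 s (s + im1 v)\<close>, and
  the multiples of \<open>\<i>\<close> added to \<open>v\<close> cancel.\<close>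

lemma conj_i_half_turn:
  fixes v :: "'a::comm_ring_1 quat"
  assumes "re v = 0" "(im1 v)\<^sup>2 + (im2 v)\<^sup>2 + (im3 v)\<^sup>2 = s\<^sup>2"
  shows "(v + qscalar s * \<i>\<^sub>q) * \<i>\<^sub>q * qcnj (v + qscalar s * \<i>\<^sub>q) = qscalar (2 * (s + im1 v)) * v"
proof -
  have "(s + im1 v)\<^sup>2 - (im2 v)\<^sup>2 - (im3 v)\<^sup>2 = 2 * (s + im1 v) * im1 v"
    using assms(2)[unfolded power2_eq_square, symmetric]
    by (simp add: power2_eq_square algebra_simps)
  then show ?thesis
    using assms(1) unfolding quat_eq_iff sel_conj_units
    by (simp add: algebra_simps)
qed

text \<open>A vanishing cross product only tests proportionality, so the scalars introduced by
  scaling with \<open>q\<close> and by cancelling a complex right factor do no harm.\<close>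

lemma reduced_frame_exists:
  fixes v :: "real poly quat"
  assumes "re v = 0" "q \<noteq> 0" "q\<^sup>2 * ((im1 v)\<^sup>2 + (im2 v)\<^sup>2 + (im3 v)\<^sup>2) = p\<^sup>2"
  obtains A where "reduced_wrt_i A" "vcross (qvec v) (qvec (A * \<i>\<^sub>q * qcnj A)) = 0"
proof (cases "v = 0")
  case True
  then have "vcross (qvec v) (qvec (1 * \<i>\<^sub>q * qcnj 1)) = 0" by (simp add: vcross_eq_0_iff)
  then show thesis using that reduced_wrt_i_one by blast
next
  case False
  \<comment> \<open>Scaling by \<open>q\<close> makes the squared length the square of a
    polynomial.\<close>
  define w where "w = qscalar q * v"
  have w: "re w = 0" "(im1 w)\<^sup>2 + (im2 w)\<^sup>2 + (im3 w)\<^sup>2 = p\<^sup>2"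
    using assms(1,3) by (simp_all add: w_def power_mult_distrib distrib_left)
  have w0: "w \<noteq> 0" using False assms(2) by (auto simp: w_def quat_eq_iff)
  \<comment> \<open>The sign of the square root is chosen so that the bisector construction does not
    degenerate: if \<open>p + im1 w = 0\<close>, then \<open>- p + im1 w = - 2 * p\<close>, and
    \<open>p = 0\<close> would force \<open>w = 0\<close>.\<close>
  obtain s where s: "(im1 w)\<^sup>2 + (im2 w)\<^sup>2 + (im3 w)\<^sup>2 = s\<^sup>2" "s + im1 w \<noteq> 0"
  proof (cases "p + im1 w = 0")
    case True
    have "p \<noteq> 0"
    proof
      assume "p = 0"
      then have "qnorm w = 0" using w by (simp add: qnorm_def)
      then show False using w0 by simp
    qed
    then have "- p + im1 w \<noteq> 0"
    proof -
      have "im1 w = - p" using True by (simp add: eq_neg_iff_add_eq_0 add.commute)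
      then have "- p + im1 w = - 2 * p" by simp
      then show ?thesis using \<open>p \<noteq> 0\<close> by simp
    qed
    then show thesis using that[of "- p"] w(2) by simp
  qed (use that w in blast)
  define C where "C = w + qscalar s * \<i>\<^sub>q"
  have C: "C * \<i>\<^sub>q * qcnj C = qscalar (2 * (s + im1 w)) * w"
    unfolding C_def by (rule conj_i_half_turn[OF w(1) s(1)])
  have "C \<noteq> 0" using s(2) by (auto simp: C_def quat_eq_iff add.commute)
  then obtain A G where AG: "reduced_wrt_i A" "complex_quat G" "C = A * G"
    using reduced_factorization by blast
  define u where "u = A * \<i>\<^sub>q * qcnj A"
  have G0: "qnorm G \<noteq> 0" using \<open>C \<noteq> 0\<close> AG(3) by auto
  define k where "k = 2 * (s + im1 w) * q"
  have k: "k \<noteq> 0" using s(2) assms(2) by (simp add: k_def)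
  have "qscalar (qnorm G) * u = C * \<i>\<^sub>q * qcnj C"
    unfolding AG(3) u_def conj_i_mult_complex_quat[OF AG(2)] ..
  also note C
  also have "qscalar (2 * (s + im1 w)) * w = qscalar k * v"
    unfolding w_def k_def mult.assoc[symmetric] qscalar_mult ..
  finally have "qscalar (qnorm G) * u = qscalar k * v" .
  then have e: "qnorm G * im1 u = k * im1 v" "qnorm G * im2 u = k * im2 v" "qnorm G * im3 u = k * im3 v"
    by (simp_all add: quat_eq_iff)
  \<comment> \<open>Proportional vectors have vanishing two-by-two minors, after cancelling the
    nonzero factor \<open>k * qnorm G\<close>.\<close>
  have cross: "x * y' = x' * y" if "qnorm G * y = k * x" "qnorm G * y' = k * x'" for x x' y y' :: "real poly"
  proof -
    have "(k * x) * (qnorm G * y') = (k * x') * (qnorm G * y)"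
      unfolding that by (simp add: mult_ac)
    then have "(k * qnorm G) * (x * y') = (k * qnorm G) * (x' * y)" by (simp only: mult_ac)
    then show ?thesis using k G0 by simp
  qed
  have "vcross (qvec v) (qvec u) = 0"
    unfolding vcross_eq_0_iff qvec_sel by (intro conjI cross[OF e(2,3)] cross[OF e(3,1)] cross[OF e(1,2)])
  then show thesis using that AG(1) unfolding u_def by blast
qed

text \<open>The vector \<open>A \<i> A\<^sup>*\<close> has length \<open>qnorm A\<close>, so
  \<open>\<mu> * qnorm A\<close> is a polynomial square root of the squared length, with denominator
  \<open>1\<close>.\<close>

lemma ph_cond_multiple_imp_PH:
  assumes "\<alpha> \<noteq> 0" "ph_cond_multiple \<alpha> b A"
  shows "rational_PH_curve (qvec (qscalar (- 2 * inverse (to_fract \<alpha>)) * map_quat to_fract b))"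
  unfolding rational_PH_curve_iff[OF assms(1)]
proof -
  obtain \<mu> where \<mu>: "ph_numerator \<alpha> b = qscalar \<mu> * (A * \<i>\<^sub>q * qcnj A)"
    using assms(2) unfolding ph_cond_multiple_def by blast
  let ?n = "ph_numerator \<alpha> b"
  have "qnorm ?n = \<mu>\<^sup>2 * (qnorm A * qnorm A)"
    unfolding \<mu> qnorm_mult by (simp add: qnorm_def)
  moreover have "re ?n = 0"
    unfolding \<mu> by (simp del: sel_times_quat add: sel_times_quat(1)[of "qscalar \<mu>"])
  ultimately have "1\<^sup>2 * ((im1 ?n)\<^sup>2 + (im2 ?n)\<^sup>2 + (im3 ?n)\<^sup>2) = (\<mu> * qnorm A)\<^sup>2"
    by (simp add: qnorm_def[of ?n] power_mult_distrib power2_eq_square[of "qnorm A"])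
  then show "\<exists>p q. q \<noteq> 0 \<and> q\<^sup>2 * ((im1 ?n)\<^sup>2 + (im2 ?n)\<^sup>2 + (im3 ?n)\<^sup>2) = p\<^sup>2"
    using one_neq_zero by blast
qed

theorem theorem3p6:
  shows "(\<forall>\<alpha> b A. \<alpha> \<noteq> 0 \<and> vectorial b \<and> reduced_wrt_i A \<longrightarrow>
            motion_polynomial (ph_motion \<alpha> b A) \<and>
            origin_trajectory (ph_motion \<alpha> b A) =
              qscalar (- 2 * inverse (to_fract \<alpha>)) * map_quat to_fract b \<and>
            (ph_cond_cross \<alpha> b A \<longleftrightarrow> ph_cond_inner \<alpha> b A) \<and>
            (ph_cond_inner \<alpha> b A \<longleftrightarrow> ph_cond_multiple \<alpha> b A)) \<and>
         (\<forall>r. rational_PH_curve r \<longleftrightarrow>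
            (\<exists>\<alpha> b A. \<alpha> \<noteq> 0 \<and> vectorial b \<and> reduced_wrt_i A \<and>
               (ph_cond_cross \<alpha> b A \<or> ph_cond_inner \<alpha> b A \<or> ph_cond_multiple \<alpha> b A) \<and>
               r = qvec (origin_trajectory (ph_motion \<alpha> b A))))"
proof (intro conjI allI)
  have conds: "(ph_cond_cross \<alpha> b A \<longleftrightarrow> ph_cond_inner \<alpha> b A) \<and>
      (ph_cond_inner \<alpha> b A \<longleftrightarrow> ph_cond_multiple \<alpha> b A)" if "vectorial b" "reduced_wrt_i A" for \<alpha> b A
    using that ph_cond_multiple_imp_cross ph_cond_cross_imp_inner ph_cond_inner_imp_multiple
      reduced_wrt_i_nonzero by blast
  then show "\<alpha> \<noteq> 0 \<and> vectorial b \<and> reduced_wrt_i A \<longrightarrow>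
      motion_polynomial (ph_motion \<alpha> b A) \<and>
      origin_trajectory (ph_motion \<alpha> b A) =
        qscalar (- 2 * inverse (to_fract \<alpha>)) * map_quat to_fract b \<and>
      (ph_cond_cross \<alpha> b A \<longleftrightarrow> ph_cond_inner \<alpha> b A) \<and>
      (ph_cond_inner \<alpha> b A \<longleftrightarrow> ph_cond_multiple \<alpha> b A)" for \<alpha> b A
    using motion_polynomial_ph_motion origin_trajectory_ph_motion reduced_wrt_i_nonzero by blast
  fix r
  show "rational_PH_curve r \<longleftrightarrow>
      (\<exists>\<alpha> b A. \<alpha> \<noteq> 0 \<and> vectorial b \<and> reduced_wrt_i A \<and>
         (ph_cond_cross \<alpha> b A \<or> ph_cond_inner \<alpha> b A \<or> ph_cond_multiple \<alpha> b A) \<and>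
         r = qvec (origin_trajectory (ph_motion \<alpha> b A)))" (is "_ \<longleftrightarrow> ?motion")
  proof
    assume PH: "rational_PH_curve r"
    obtain \<alpha> b where ab: "\<alpha> \<noteq> 0" "vectorial b"
      "r = qvec (qscalar (- 2 * inverse (to_fract \<alpha>)) * map_quat to_fract b)"
      by (rule common_denominator)
    \<comment> \<open>Any representation of \<open>r\<close> by \<alpha> and \<open>b\<close> will
      do; the PH property enters only in finding \<open>A\<close>.\<close>
    obtain A where "reduced_wrt_i A" "ph_cond_cross \<alpha> b A"
      using PH reduced_frame_exists[OF re_ph_numerator[OF ab(2)]]
      unfolding ab(3) rational_PH_curve_iff[OF ab(1)] ph_cond_cross_def by metis
    moreover from this have "r = qvec (origin_trajectory (ph_motion \<alpha> b A))"
      using ab origin_trajectory_ph_motion reduced_wrt_i_nonzero by simp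
    ultimately show ?motion using ab by blast
  next
    assume ?motion
    \<comment> \<open>Whichever condition is given, \<open>conds\<close> converts it into the
      existence of \<mu>.\<close>
    then obtain \<alpha> b A where "\<alpha> \<noteq> 0" "vectorial b" "reduced_wrt_i A" "ph_cond_multiple \<alpha> b A"
      "r = qvec (origin_trajectory (ph_motion \<alpha> b A))"
      using conds by blast
    then show "rational_PH_curve r"
      using ph_cond_multiple_imp_PH origin_trajectory_ph_motion reduced_wrt_i_nonzero by metis
  qed
qed

end
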